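(* Let $a,b$ be positive integers with $d=\gcd(a,b)>1$. Then for any integers $c>1$ and $0<r<\min\left\{\frac{a}{d},\frac{b}{d},d\right\}$, the vector $v$ with coordinates $$v_{12}=1,\quad v_{13}=a,\quad v_{14}=b,\quad v_{23}=ac,\quad v_{24}=bc,\quad v_{34}=r$$ is an interior point of $\mathrm{Pl}_{4,2}(\mathbb{Z})$ that does not belong to $\mathcal{V}^{\rm sf}_{4,2}(\mathbb{Z})$; that is, there are no lattice polytopes $P_1,\dots,P_4$ in $\mathbb{R}^2$ with $v_{ij}=V(P_i,P_j)$ for all $1\leq i<j\leq 4$.
   Context: A lattice polytope in $\mathbb{R}^2$ is the convex hull of a nonempty finite subset of $\mathbb{Z}^2$ (points and segments are allowed). For lattice polytopes $P,Q$ in $\mathbb{R}^2$ the normalized mixed area is $V(P,Q)=\frac12\left(\mathrm{Vol}_2(P+Q)-\mathrm{Vol}_2(P)-\mathrm{Vol}_2(Q)\right)$, where $P+Q$ is the Minkowski sum and $\mathrm{Vol}_2$ is twice the Euclidean area. Square-free quadratic forms $\sum_{1\le i<j\le 4}v_{ij}x_ix_j$ are identified with their coefficient vectors $v=(v_{ij})_{1\le i<j\le 4}$. The discrete Plücker set $\mathrm{Pl}_{4,2}(\mathbb{Z})$ is the set of all such $v$ with $v_{ij}\in\mathbb{Z}_{\geq 0}$ satisfying the three Plücker-type inequalities $$v_{12}v_{34}+v_{13}v_{24}\geq v_{14}v_{23},\quad v_{13}v_{24}+v_{14}v_{23}\geq v_{12}v_{34},\quad v_{14}v_{23}+v_{12}v_{34}\geq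 v_{13}v_{24}.$$ A point $v\in\mathrm{Pl}_{4,2}(\mathbb{Z})$ is a boundary point if at least one of these inequalities is an equality at $v$; otherwise it is an interior point. The set $\mathcal{V}^{\rm sf}_{4,2}(\mathbb{Z})$ consists of all $v$ of the form $v_{ij}=V(P_i,P_j)$, $1\le i<j\le 4$, for lattice polytopes $P_1,\dots,P_4$ in $\mathbb{R}^2$. *)

theory Defs
  imports "HOL-Analysis.Analysis"
begin

definition lattice_polytope :: "(real ^ 2) set \<Rightarrow> bool" where
  "lattice_polytope P \<longleftrightarrow>
     (\<exists>S. finite S \<and> S \<noteq> {} \<and> (\<forall>x\<in>S. \<forall>i. x $ i \<in> \<int>) \<and> P = convex hull S)"

definition Vol2 :: "(real ^ 2) set \<Rightarrow> real" where
  "Vol2 P = 2 * measure lebesgue P"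

text \<open>Here \<open>P + Q\<close> is the Minkowski sum (pointwise addition of sets, from Set_Algebras).\<close>

definition mixed_area :: "(real ^ 2) set \<Rightarrow> (real ^ 2) set \<Rightarrow> real" where
  "mixed_area P Q = (1/2) * (Vol2 (P + Q) - Vol2 P - Vol2 Q)"

text \<open>
  The square-free quadratic form with coefficients \<open>v\<^sub>i\<^sub>j\<close>, \<open>1 \<le> i < j \<le> 4\<close>, is encoded by a function
  \<open>v :: nat \<Rightarrow> nat \<Rightarrow> real\<close>. The sets below only inspect its values at those six index pairs; the
  values at all other pairs are irrelevant.
\<close>

definition Pl42_Z :: "(nat \<Rightarrow> nat \<Rightarrow> real) set" where
  "Pl42_Z = {v. (\<forall>i j. 1 \<le> i \<and> i < j \<and> j \<le> 4 \<longrightarrow> v i j \<in> \<int> \<and> v i j \<ge> 0) \<and>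
     v 1 2 * v 3 4 + v 1 3 * v 2 4 \<ge> v 1 4 * v 2 3 \<and>
     v 1 3 * v 2 4 + v 1 4 * v 2 3 \<ge> v 1 2 * v 3 4 \<and>
     v 1 4 * v 2 3 + v 1 2 * v 3 4 \<ge> v 1 3 * v 2 4}"

definition Pl42_Z_boundary :: "(nat \<Rightarrow> nat \<Rightarrow> real) set" where
  "Pl42_Z_boundary = {v \<in> Pl42_Z.
     v 1 2 * v 3 4 + v 1 3 * v 2 4 = v 1 4 * v 2 3 \<or>
     v 1 3 * v 2 4 + v 1 4 * v 2 3 = v 1 2 * v 3 4 \<or>
     v 1 4 * v 2 3 + v 1 2 * v 3 4 = v 1 3 * v 2 4}"

definition Pl42_Z_interior :: "(nat \<Rightarrow> nat \<Rightarrow> real) set" where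
  "Pl42_Z_interior = Pl42_Z - Pl42_Z_boundary"

definition Vsf42_Z :: "(nat \<Rightarrow> nat \<Rightarrow> real) set" where
  "Vsf42_Z = {v. \<exists>P :: nat \<Rightarrow> (real ^ 2) set.
     (\<forall>i. 1 \<le> i \<and> i \<le> 4 \<longrightarrow> lattice_polytope (P i)) \<and>
     (\<forall>i j. 1 \<le> i \<and> i < j \<and> j \<le> 4 \<longrightarrow> v i j = mixed_area (P i) (P j))}"

end

theory Submission
  imports Defs
begin

text \<open>
  The mixed area of the segment \<open>[x, y]\<close> and \<open>Q\<close> is the width of \<open>Q\<close> with respect to
  \<open>det(y - x, \<cdot>)\<close>, and every segment in \<open>P\<close> gives in this way a lower bound for \<open>V(P, Q)\<close>.
  Since \<open>V(P\<^sub>1, P\<^sub>2) = 1\<close>, either one of \<open>P\<^sub>1, P\<^sub>2\<close> is a primitive segment, or both are unimodular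
  triangles; triangles that are reflections of each other have mixed area 2, so in the second case
  \<open>P\<^sub>2\<close> is a translate of \<open>P\<^sub>1\<close>, which contradicts \<open>a \<noteq> ac\<close>. In the first case \<open>P\<^sub>3\<close> and
  \<open>P\<^sub>4\<close> contain lattice segments of heights \<open>A\<close> and \<open>B\<close> over the given one, where \<open>(A, B)\<close> is
  \<open>(a, b)\<close> or \<open>(ac, bc)\<close>. The determinant of these two segments is a multiple of \<open>D = gcd(A, B)\<close>
  and at most \<open>r < D\<close>, so they are parallel. Their lattice lengths are multiples of \<open>A/D\<close> and
  \<open>B/D\<close>, both larger than \<open>r\<close>, so \<open>P\<^sub>3\<close> and \<open>P\<^sub>4\<close> are contained in parallel lines and
  \<open>r = V(P\<^sub>3, P\<^sub>4) = 0\<close>.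
\<close>

section \<open>The planar determinant, and the area of a convex set plus a segment\<close>

lemma compact_set_plus:
  fixes P Q :: "'a :: real_normed_vector set"
  assumes "compact P" "compact Q" shows "compact (P + Q)"
proof -
  have "P + Q = {x + y | x y. x \<in> P \<and> y \<in> Q}"
    unfolding set_plus_def by auto
  then show ?thesis
    using compact_sums [OF assms] by simp
qed

definition det2 :: "real ^ 2 \<Rightarrow> real ^ 2 \<Rightarrow> real" where
  "det2 x y = x $ 1 * y $ 2 - x $ 2 * y $ 1"

lemma det2_simps:
  "det2 (x + y) z = det2 x z + det2 y z" "det2 x (y + z) = det2 x y + det2 x z"
  "det2 (x - y) z = det2 x z - det2 y z" "det2 x (y - z) = det2 x y - det2 x z"
  "det2 (k *\<^sub>R x) y = k * det2 x y" "det2 x (k *\<^sub>R y) = k * det2 x y"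
  "det2 (- x) y = - det2 x y" "det2 x (- y) = - det2 x y"
  "det2 0 y = 0" "det2 x 0 = 0" "det2 x x = 0"
  by (simp_all add: det2_def algebra_simps)

lemma det2_swap: "det2 y x = - det2 x y"
  by (simp add: det2_def)

text \<open>Cramer's rule with the denominator cleared: division by a nonzero
  \<open>det2 u v\<close> gives the coordinates of \<open>x\<close> in the basis \<open>u\<close>,
  \<open>v\<close>.\<close>

lemma det2_expand: "det2 u v *\<^sub>R x = det2 x v *\<^sub>R u + det2 u x *\<^sub>R v"
  by (simp add: vec_eq_iff forall_2 det2_def algebra_simps)

lemma bounded_linear_det2: "bounded_linear (det2 s)"
  by (simp add: linear_conv_bounded_linear [symmetric] linear_iff det2_simps)

lemma continuous_on_det2 [continuous_intros]:
  "continuous_on A f \<Longrightarrow> continuous_on A g \<Longrightarrow> continuous_on A (\<lambda>x. det2 (f x) (g x))"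
  unfolding det2_def by (intro continuous_intros)

lemma negligible_det2_line:
  assumes "s \<noteq> 0" shows "negligible {x. det2 s x = k}"
proof -
  \<comment> \<open>A quarter turn of \<open>s\<close> is a normal vector of the line: its inner
    product with \<open>x\<close> is \<open>det2 s x\<close>.\<close>
  have "vector [- (s $ 2), s $ 1] \<noteq> (0 :: real ^ 2)"
    using assms by (auto simp: vec_eq_iff forall_2)
  then have "negligible {x :: real ^ 2. vector [- (s $ 2), s $ 1] \<bullet> x = k}"
    by (intro negligible_hyperplane disjI1)
  then show ?thesis
    by (simp add: det2_def inner_vec_def sum_2 algebra_simps)
qed

lemma det2_between_convex_hull:
  assumes "\<And>x. x \<in> S \<Longrightarrow> l \<le> det2 s x \<and> det2 s x \<le> u" and "x \<in> convex hull S"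
  shows "l \<le> det2 s x \<and> det2 s x \<le> u"
proof -
  have "convex (det2 s -` {l..u})"
    by (intro convex_linear_vimage bounded_linear.linear bounded_linear_det2) auto
  then have "convex hull S \<subseteq> det2 s -` {l..u}"
    using assms(1) by (intro hull_minimal) auto
  with assms(2) show ?thesis by auto
qed

lemma measure_parallelogram:
  fixes p s t :: "real ^ 2"
  defines "M \<equiv> {p + x *\<^sub>R s + y *\<^sub>R t | x y. 0 \<le> x \<and> x \<le> 1 \<and> 0 \<le> y \<and> y \<le> 1}"
  shows "measure lebesgue M = \<bar>det2 s t\<bar>"
proof -
  let ?f = "\<lambda>z :: real ^ 2. z $ 1 *\<^sub>R s + z $ 2 *\<^sub>R t"
  let ?C = "cbox 0 1 :: (real ^ 2) set"
  have lin: "linear ?f"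
    by (simp add: linear_iff algebra_simps)
  have det: "det (matrix ?f) = det2 s t"
    by (simp add: det_2 matrix_def axis_def det2_def)
  have M: "M = (+) p ` ?f ` ?C"
  proof (intro subset_antisym subsetI)
    fix q assume "q \<in> M"
    then obtain x y where *: "q = p + x *\<^sub>R s + y *\<^sub>R t" "0 \<le> x" "x \<le> 1" "0 \<le> y" "y \<le> 1"
      unfolding M_def by blast
    then have "q = p + ?f (vector [x, y])" "vector [x, y] \<in> ?C"
      by (auto simp: mem_box_cart forall_2 add.assoc)
    then show "q \<in> (+) p ` ?f ` ?C" by blast
  next
    fix q assume "q \<in> (+) p ` ?f ` ?C"
    then obtain z where "z \<in> ?C" "q = p + ?f z" by blast
    then show "q \<in> M"
      unfolding M_def by (auto simp: mem_box_cart forall_2 add.assoc)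
  qed
  have "measure lebesgue (?f ` ?C) = \<bar>det2 s t\<bar> * measure lebesgue ?C"
    using measure_linear_image [OF lin, of ?C] det by simp
  also have "measure lebesgue ?C = 1"
    by (simp add: content_cbox_if_cart interval_eq_empty_cart)
  finally show "measure lebesgue M = \<bar>det2 s t\<bar>"
    unfolding M by (simp only: measure_translation)
qed

text \<open>Used with \<open>l = u\<close> to cut a set along a line, and with general bounds to
  isolate a strip.\<close>

lemma measure_split_level:
  fixes f :: "'a :: euclidean_space \<Rightarrow> real"
  assumes A: "A \<in> lmeasurable" and f: "continuous_on UNIV f" and "l \<le> u"
  shows "measure lebesgue A = measure lebesgue (A \<inter> {x. f x < l}) +
    measure lebesgue (A \<inter> {x. l \<le> f x \<and> f x \<le> u}) + measure lebesgue (A \<inter> {x. u < f x})"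
proof -
  have o: "open {x. f x < l}" "open {x. u < f x}" and c: "closed {x. l \<le> f x \<and> f x \<le> u}"
    by (auto intro!: open_Collect_less closed_Collect_conj closed_Collect_le f continuous_intros)
  have meas: "A \<inter> {x. f x < l} \<in> lmeasurable" "A \<inter> {x. l \<le> f x \<and> f x \<le> u} \<in> lmeasurable"
    "A \<inter> {x. u < f x} \<in> lmeasurable"
    using A o c by (auto intro!: fmeasurable_Int_fmeasurable)
  have "A = (A \<inter> {x. f x < l} \<union> A \<inter> {x. l \<le> f x \<and> f x \<le> u}) \<union> A \<inter> {x. u < f x}"
    by auto
  also have "measure lebesgue \<dots> =
      measure lebesgue (A \<inter> {x. f x < l} \<union> A \<inter> {x. l \<le> f x \<and> f x \<le> u}) + measure lebesgue (A \<inter> {x. u < f x})"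
    using meas \<open>l \<le> u\<close> by (intro measure_Un_AE fmeasurable.Un) auto
  also have "measure lebesgue (A \<inter> {x. f x < l} \<union> A \<inter> {x. l \<le> f x \<and> f x \<le> u}) =
      measure lebesgue (A \<inter> {x. f x < l}) + measure lebesgue (A \<inter> {x. l \<le> f x \<and> f x \<le> u})"
    using meas by (intro measure_Un_AE) auto
  finally show ?thesis .
qed

text \<open>The chord of \<open>Q\<close> from \<open>b\<close> to \<open>t\<close> cuts \<open>Q\<close> into two parts. Adding the segment moves
  one of them by \<open>s\<close> and inserts a parallelogram between them.\<close>

lemma measure_plus_segment:
  fixes Q :: "(real ^ 2) set"
  assumes Q: "compact Q" "convex Q" and bt: "b \<in> Q" "t \<in> Q"
    and ext: "\<And>q. q \<in> Q \<Longrightarrow> det2 s b \<le> det2 s q \<and> det2 s q \<le> det2 s t"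
  shows "measure lebesgue (Q + closed_segment 0 s) = measure lebesgue Q + det2 s (t - b)"
proof (cases "det2 s t = det2 s b")
  case True
  show ?thesis
  proof (cases "s = 0")
    case True
    then show ?thesis by (simp add: det2_simps)
  next
    case False
    \<comment> \<open>In this case \<open>Q\<close> has width 0, so \<open>Q\<close> and the sum lie
      on one line parallel to \<open>s\<close> and both have area 0.\<close>
    have "Q + closed_segment 0 s \<subseteq> {x. det2 s x = det2 s b}" "Q \<subseteq> {x. det2 s x = det2 s b}"
      using ext True by (force simp: set_plus_def closed_segment_def det2_simps)+
    then show ?thesis
      using negligible_subset [OF negligible_det2_line [OF False]] True
      by (metis add_0 det2_simps(4) diff_self negligible_imp_measure0)
  qed
next
  case False
  define d where "d = t - b"
  define D where "D = det2 s d"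
  have D: "D > 0"
    using False ext [OF bt(1)] ext [OF bt(2)] by (simp add: D_def d_def det2_simps)
  \<comment> \<open>Coordinates with origin \<open>b\<close>: \<beta> along \<open>s\<close> and
    \<alpha> along the chord vector \<open>d\<close>. On \<open>Q\<close> the value of \<alpha> lies
    in [0, 1], and the chord has \<beta> = 0.\<close>
  define \<alpha> where "\<alpha> x = det2 s (x - b) / D" for x
  define \<beta> where "\<beta> x = det2 (x - b) d / D" for x
  define R where "R = Q + closed_segment 0 s"
  define M where "M = {b + x *\<^sub>R s + y *\<^sub>R d | x y. 0 \<le> x \<and> x \<le> 1 \<and> 0 \<le> y \<and> y \<le> 1}"
  have coord: "x = b + \<beta> x *\<^sub>R s + \<alpha> x *\<^sub>R d" for x
  proof -
    have "D *\<^sub>R (x - b) = D *\<^sub>R (\<beta> x *\<^sub>R s + \<alpha> x *\<^sub>R d)"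
      using det2_expand [of s d "x - b"] D by (simp add: D_def \<alpha>_def \<beta>_def scaleR_add_right)
    then have "x - b = \<beta> x *\<^sub>R s + \<alpha> x *\<^sub>R d"
      using D by (metis order_less_irrefl real_vector.scale_cancel_left)
    then show ?thesis
      by (simp add: algebra_simps)
  qed
  have \<beta>I: "\<beta> (b + x *\<^sub>R s + y *\<^sub>R d) = x" and \<alpha>I: "\<alpha> (b + x *\<^sub>R s + y *\<^sub>R d) = y" for x y
    using D by (simp_all add: \<alpha>_def \<beta>_def det2_simps D_def)
  have \<beta>s: "\<beta> (x + k *\<^sub>R s) = \<beta> x + k" and \<alpha>s: "\<alpha> (x + k *\<^sub>R s) = \<alpha> x" for x k
    using D by (simp_all add: \<alpha>_def \<beta>_def det2_simps D_def field_simps)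
  have \<alpha>01: "0 \<le> \<alpha> x" "\<alpha> x \<le> 1" if "x \<in> Q" for x
    using ext [OF that] D by (simp_all add: \<alpha>_def D_def d_def det2_simps)
  have base: "b + y *\<^sub>R d \<in> Q" if "0 \<le> y" "y \<le> 1" for y
    using convexD_alt [OF Q(2) bt that] by (simp add: d_def algebra_simps)
  \<comment> \<open>The chord contains a point with the same \<alpha> as \<open>x\<close>, so by
    convexity \<open>x\<close> may be moved parallel to \<open>s\<close> up to the chord without
    leaving \<open>Q\<close>.\<close>
  have key: "b + k *\<^sub>R s + \<alpha> x *\<^sub>R d \<in> Q"
    if x: "x \<in> Q" and k: "\<beta> x \<le> k \<and> k \<le> 0 \<or> 0 \<le> k \<and> k \<le> \<beta> x" for x k
  proof (cases "\<beta> x = 0")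
    case True
    with k have "k = 0" by auto
    then show ?thesis using base [OF \<alpha>01 [OF x]] by simp
  next
    case False
    define m where "m = k / \<beta> x"
    have m: "0 \<le> m" "m \<le> 1" "k = m * \<beta> x"
      using k False by (auto simp: m_def divide_simps)
    have "(1 - m) *\<^sub>R (b + \<alpha> x *\<^sub>R d) + m *\<^sub>R (b + \<beta> x *\<^sub>R s + \<alpha> x *\<^sub>R d) \<in> Q"
      using convexD_alt [OF Q(2) base [OF \<alpha>01 [OF x]] x m(1,2)] coord [of x] by simp
    then show ?thesis
      by (simp add: m(3) algebra_simps)
  qed
  have in_R: "q \<in> R \<longleftrightarrow> (\<exists>x\<in>Q. \<exists>k. 0 \<le> k \<and> k \<le> 1 \<and> q = x + k *\<^sub>R s)" for q
    unfolding R_def set_plus_def closed_segment_def by auto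
  \<comment> \<open>Where \<beta> is negative the sum agrees with \<open>Q\<close>; for \<beta> in
    [0, 1] it fills the parallelogram; beyond that it is the right part of \<open>Q\<close> moved by
    \<open>s\<close>.\<close>
  have R1: "R \<inter> {x. \<beta> x < 0} = Q \<inter> {x. \<beta> x < 0}"
  proof (intro subset_antisym subsetI)
    fix q assume "q \<in> R \<inter> {x. \<beta> x < 0}"
    then obtain x k where x: "x \<in> Q" "0 \<le> k" "q = x + k *\<^sub>R s" and "\<beta> q < 0"
      using in_R by auto
    then have "b + \<beta> q *\<^sub>R s + \<alpha> x *\<^sub>R d \<in> Q"
      by (intro key) (auto simp: \<beta>s)
    then have "q \<in> Q"
      using coord [of q] x(3) by (simp add: \<alpha>s)
    then show "q \<in> Q \<inter> {x. \<beta> x < 0}" using \<open>\<beta> q < 0\<close> by simp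
  next
    fix q assume "q \<in> Q \<inter> {x. \<beta> x < 0}"
    moreover have "q = q + 0 *\<^sub>R s" by simp
    ultimately show "q \<in> R \<inter> {x. \<beta> x < 0}"
      using in_R by force
  qed
  have R2: "R \<inter> {x. 0 \<le> \<beta> x \<and> \<beta> x \<le> 1} = M"
  proof (intro subset_antisym subsetI)
    fix q assume "q \<in> R \<inter> {x. 0 \<le> \<beta> x \<and> \<beta> x \<le> 1}"
    then obtain x k where x: "x \<in> Q" "q = x + k *\<^sub>R s" and "0 \<le> \<beta> q" "\<beta> q \<le> 1"
      using in_R by auto
    moreover have "0 \<le> \<alpha> q" "\<alpha> q \<le> 1"
      using \<alpha>01 [OF x(1)] x(2) by (simp_all add: \<alpha>s)
    ultimately show "q \<in> M"
      unfolding M_def using coord [of q] by blast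
  next
    fix q assume "q \<in> M"
    then obtain x y where *: "q = b + x *\<^sub>R s + y *\<^sub>R d" "0 \<le> x" "x \<le> 1" "0 \<le> y" "y \<le> 1"
      unfolding M_def by blast
    then have "q = (b + y *\<^sub>R d) + x *\<^sub>R s" by simp
    then have "q \<in> R"
      using * base in_R by blast
    then show "q \<in> R \<inter> {x. 0 \<le> \<beta> x \<and> \<beta> x \<le> 1}"
      using * \<beta>I by simp
  qed
  have R3: "R \<inter> {x. 1 < \<beta> x} = (+) s ` (Q \<inter> {x. 0 < \<beta> x})"
  proof (intro subset_antisym subsetI)
    fix q assume "q \<in> R \<inter> {x. 1 < \<beta> x}"
    then obtain x k where x: "x \<in> Q" "k \<le> 1" "q = x + k *\<^sub>R s" and q: "1 < \<beta> q"
      using in_R by auto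
    then have "b + (\<beta> q - 1) *\<^sub>R s + \<alpha> x *\<^sub>R d \<in> Q"
      by (intro key) (auto simp: \<beta>s)
    moreover have "q = s + (b + (\<beta> q - 1) *\<^sub>R s + \<alpha> x *\<^sub>R d)"
      using coord [of q] x(3) by (simp add: \<alpha>s algebra_simps)
    moreover have "0 < \<beta> (b + (\<beta> q - 1) *\<^sub>R s + \<alpha> x *\<^sub>R d)"
      using q by (simp add: \<beta>I)
    ultimately show "q \<in> (+) s ` (Q \<inter> {x. 0 < \<beta> x})"
      by blast
  next
    fix q assume "q \<in> (+) s ` (Q \<inter> {x. 0 < \<beta> x})"
    then obtain x where x: "x \<in> Q" "0 < \<beta> x" "q = x + 1 *\<^sub>R s" by auto
    then show "q \<in> R \<inter> {x. 1 < \<beta> x}"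
      using in_R [of q] \<beta>s [of x 1] by (auto intro!: bexI [of _ x] exI [of _ 1])
  qed
  have cont: "continuous_on UNIV \<beta>"
    unfolding \<beta>_def by (intro continuous_intros) (use D in auto)
  have "d \<noteq> 0"
    using D by (auto simp: D_def det2_simps)
  have "compact R"
    unfolding R_def by (intro compact_set_plus Q compact_segment)
  then have lm: "R \<in> lmeasurable" "Q \<in> lmeasurable"
    using Q(1) lmeasurable_compact by auto
  \<comment> \<open>\<open>R1\<close> and \<open>R3\<close> account for \<open>Q\<close> without the
    chord, so the chord has to have area 0.\<close>
  have null: "measure lebesgue (Q \<inter> {x. \<beta> x = 0}) = 0"
  proof (rule negligible_imp_measure0, rule negligible_subset)
    show "negligible {x. det2 d x = det2 d b}"
      by (rule negligible_det2_line) fact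
    show "Q \<inter> {x. \<beta> x = 0} \<subseteq> {x. det2 d x = det2 d b}"
      using D by (auto simp: \<beta>_def det2_simps det2_swap [of d])
  qed
  have "measure lebesgue R = measure lebesgue (R \<inter> {x. \<beta> x < 0}) +
      measure lebesgue (R \<inter> {x. 0 \<le> \<beta> x \<and> \<beta> x \<le> 1}) + measure lebesgue (R \<inter> {x. 1 < \<beta> x})"
    by (intro measure_split_level cont lm) simp
  also have "\<dots> = measure lebesgue (Q \<inter> {x. \<beta> x < 0}) + D + measure lebesgue (Q \<inter> {x. 0 < \<beta> x})"
    unfolding R1 R2 R3 measure_translation M_def measure_parallelogram
    using D by (simp add: D_def)
  finally have "measure lebesgue R = measure lebesgue Q + D"
    using measure_split_level [OF lm(2) cont, of 0 0] null by (simp flip: eq_iff add: conj_commute)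
  then show ?thesis
    by (simp add: R_def D_def d_def)
qed


lemma det2_extrema:
  fixes Q :: "(real ^ 2) set"
  assumes "compact Q" "Q \<noteq> {}"
  obtains b t where "b \<in> Q" "t \<in> Q" "\<And>q. q \<in> Q \<Longrightarrow> det2 s b \<le> det2 s q \<and> det2 s q \<le> det2 s t"
proof -
  have "continuous_on Q (det2 s)"
    by (intro continuous_intros)
  then show thesis
    using continuous_attains_sup [OF assms] continuous_attains_inf [OF assms] that by metis
qed

subsection \<open>Lower bounds for the mixed area\<close>

lemma mixed_area_alt:
  "mixed_area P Q = measure lebesgue (P + Q) - measure lebesgue P - measure lebesgue Q"
  by (simp add: mixed_area_def Vol2_def)

lemma mixed_area_commute: "mixed_area P Q = mixed_area Q P"
  by (simp add: mixed_area_alt add.commute)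

lemma translation_set_plus: "((+) p ` P) + Q = (+) (p :: 'a :: ab_semigroup_add) ` (P + Q)"
  by (force simp: set_plus_def add.assoc)

lemma mixed_area_translation: "mixed_area ((+) p ` P) Q = mixed_area P Q"
  by (simp add: mixed_area_alt translation_set_plus measure_translation)

lemma closed_segment_translation_0: "closed_segment x y = (+) x ` closed_segment 0 (y - x)"
  for x y :: "'a :: real_vector"
  using closed_segment_translation [of x 0 "y - x"] by simp

lemma mixed_area_segment:
  assumes Q: "compact Q" "convex Q" and bt: "b \<in> Q" "t \<in> Q"
    and ext: "\<And>q. q \<in> Q \<Longrightarrow> det2 (y - x) b \<le> det2 (y - x) q \<and> det2 (y - x) q \<le> det2 (y - x) t"
  shows "mixed_area (closed_segment x y) Q = det2 (y - x) (t - b)"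
proof -
  have "measure lebesgue (closed_segment 0 (y - x)) = 0"
    \<comment> \<open>For \<open>Q = {0}\<close> the width is 0, so a segment has area 0.\<close>
    using measure_plus_segment [of "{0}" 0 0 "y - x"] by (simp add: det2_simps)
  then show ?thesis
    using measure_plus_segment [OF assms]
    unfolding closed_segment_translation_0 [of x y] mixed_area_translation
    by (simp add: mixed_area_alt add.commute [of Q])
qed

text \<open>Cut \<open>P\<close> along the line through \<open>x\<close> and \<open>y\<close>. The two parts of \<open>P\<close>, moved to a lowest and
  to a highest point of \<open>Q\<close>, and \<open>Q\<close> plus the segment from \<open>x\<close> to \<open>y\<close> lie without
  overlap in \<open>P + Q\<close>. This replaces the general monotonicity of mixed areas.\<close>

lemma mixed_area_ge:
  assumes P: "compact P" "convex P" and Q: "compact Q" "convex Q"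
    and xy: "x \<in> P" "y \<in> P" "x \<noteq> y" and bt: "b \<in> Q" "t \<in> Q"
  shows "\<bar>det2 (y - x) (t - b)\<bar> \<le> mixed_area P Q"
proof -
  define s where "s = y - x"
  define f where "f = det2 s"
  define k where "k = f x"
  have s: "s \<noteq> 0" using xy by (simp add: s_def)
  have f_add: "f (p + q) = f p + f q" for p q by (simp add: f_def det2_simps)
  \<comment> \<open>The given \<open>b\<close> and \<open>t\<close> need not be extremal. The mixed
    area is bounded below by the full width \<open>f (t0 - b0)\<close> of \<open>Q\<close>, which
    dominates the absolute value of \<open>f (t - b)\<close>.\<close>
  obtain b0 t0 where bt0: "b0 \<in> Q" "t0 \<in> Q" and ext: "\<And>q. q \<in> Q \<Longrightarrow> f b0 \<le> f q \<and> f q \<le> f t0"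
    using det2_extrema [OF Q(1)] bt(1) unfolding f_def by (metis empty_iff)
  have fy: "f y = k"
    by (simp add: k_def f_def s_def det2_def algebra_simps)
  have seg: "closed_segment x y \<subseteq> P"
    using closed_segment_subset [OF xy(1,2) P(2)] .
  have f_seg: "f z = k" if z: "z \<in> closed_segment x y" for z
  proof -
    obtain u where "z = (1 - u) *\<^sub>R x + u *\<^sub>R y"
      using z by (auto simp: in_segment)
    then have "f z = (1 - u) * f x + u * f y" by (simp add: f_def det2_simps)
    then show ?thesis using fy k_def by (simp add: algebra_simps)
  qed
  have cont: "continuous_on UNIV f"
    unfolding f_def by (intro continuous_intros)
  have lm: "P \<in> lmeasurable" "P + Q \<in> lmeasurable"
    using P(1) Q(1) by (auto intro: lmeasurable_compact compact_set_plus)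
  have open_f: "open {x. f x < l}" "open {x. l < f x}" and closed_f: "closed {x. l \<le> f x \<and> f x \<le> u}" for l u
    by (auto intro!: open_Collect_less closed_Collect_conj closed_Collect_le cont continuous_intros)
  have lmI: "R \<inter> {x. f x < l} \<in> lmeasurable" "R \<inter> {x. l < f x} \<in> lmeasurable"
    "R \<inter> {x. l \<le> f x \<and> f x \<le> u} \<in> lmeasurable" if "R \<in> lmeasurable" for R l u
    using that open_f closed_f by (auto intro!: fmeasurable_Int_fmeasurable)
  have moved: "measure lebesgue A \<le> measure lebesgue B"
    if "(+) p ` A \<subseteq> B" "A \<in> lmeasurable" "B \<in> lmeasurable" for p A B
    using measure_mono_fmeasurable [OF that(1) fmeasurableD [OF measurable_translation [OF that(2)]] that(3)]
    unfolding measure_translation .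
  have "measure lebesgue P = measure lebesgue (P \<inter> {x. f x < k}) + measure lebesgue (P \<inter> {x. k < f x})"
  proof -
    have "P \<inter> {x. k \<le> f x \<and> f x \<le> k} \<subseteq> {x. det2 s x = k}"
      by (auto simp: f_def)
    then have "measure lebesgue (P \<inter> {x. k \<le> f x \<and> f x \<le> k}) = 0"
      by (intro negligible_imp_measure0 negligible_subset [OF negligible_det2_line [OF s]])
    then show ?thesis
      using measure_split_level [OF lm(1) cont order_refl, of k] by linarith
  qed
  moreover have "measure lebesgue (P \<inter> {x. f x < k}) \<le> measure lebesgue ((P + Q) \<inter> {x. f x < k + f b0})"
  proof -
    have "(+) b0 ` (P \<inter> {x. f x < k}) \<subseteq> (P + Q) \<inter> {x. f x < k + f b0}"
    proof -
      have "b0 + z \<in> P + Q" if "z \<in> P" for z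
        using set_plus_intro [OF that, of b0 Q] bt0 by (simp only: add.commute)
      then show ?thesis by (auto simp: f_add)
    qed
    then show ?thesis
      by (rule moved) (intro lmI lm)+
  qed
  moreover have "measure lebesgue (P \<inter> {x. k < f x}) \<le> measure lebesgue ((P + Q) \<inter> {x. k + f t0 < f x})"
  proof -
    have "(+) t0 ` (P \<inter> {x. k < f x}) \<subseteq> (P + Q) \<inter> {x. k + f t0 < f x}"
    proof -
      have "t0 + z \<in> P + Q" if "z \<in> P" for z
        using set_plus_intro [OF that, of t0 Q] bt0 by (simp only: add.commute)
      then show ?thesis by (auto simp: f_add)
    qed
    then show ?thesis
      by (rule moved) (intro lmI lm)+
  qed
  moreover have "measure lebesgue Q + f (t0 - b0)
      \<le> measure lebesgue ((P + Q) \<inter> {x. k + f b0 \<le> f x \<and> f x \<le> k + f t0})"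
  proof -
    have eq: "closed_segment x y + Q = (+) x ` (Q + closed_segment 0 s)"
      unfolding closed_segment_translation_0 [of x y] translation_set_plus s_def
      by (subst add.commute) simp
    have "closed_segment x y + Q \<subseteq> (P + Q) \<inter> {x. k + f b0 \<le> f x \<and> f x \<le> k + f t0}"
      using seg f_seg ext by (fastforce simp: f_add set_plus_def)
    moreover have "closed_segment x y + Q \<in> sets lebesgue"
      using Q(1) by (intro fmeasurableD lmeasurable_compact compact_set_plus) auto
    ultimately have "measure lebesgue (closed_segment x y + Q)
        \<le> measure lebesgue ((P + Q) \<inter> {x. k + f b0 \<le> f x \<and> f x \<le> k + f t0})"
      by (intro measure_mono_fmeasurable lmI(3) lm)
    then show ?thesis
      using measure_plus_segment [OF Q bt0, of s] ext unfolding eq measure_translation f_def by auto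
  qed
  moreover have "measure lebesgue (P + Q) = measure lebesgue ((P + Q) \<inter> {x. f x < k + f b0}) +
      measure lebesgue ((P + Q) \<inter> {x. k + f b0 \<le> f x \<and> f x \<le> k + f t0}) +
      measure lebesgue ((P + Q) \<inter> {x. k + f t0 < f x})"
    using ext [OF bt0(1)] by (intro measure_split_level lm cont) auto
  ultimately have "f (t0 - b0) \<le> mixed_area P Q"
    unfolding mixed_area_alt by linarith
  moreover have "\<bar>f (t - b)\<bar> \<le> f (t0 - b0)"
    using ext [OF bt(1)] ext [OF bt(2)] by (auto simp: f_def det2_simps)
  ultimately show ?thesis
    by (simp add: f_def s_def)
qed

text \<open>The sum of sets on two parallel lines lies on a third parallel line, so all three areas
  vanish.\<close>

lemma mixed_area_parallel:
  assumes "s \<noteq> 0" "P \<subseteq> {x. det2 s x = k}" "Q \<subseteq> {x. det2 s x = l}"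
  shows "mixed_area P Q = 0"
proof -
  have "P + Q \<subseteq> {x. det2 s x = k + l}"
    using assms(2,3) by (fastforce simp: set_plus_def det2_simps)
  with assms have "negligible P" "negligible Q" "negligible (P + Q)"
    using negligible_det2_line negligible_subset by metis+
  then show ?thesis
    by (simp add: mixed_area_alt negligible_imp_measure0)
qed

subsection \<open>Lattice polygons\<close>

definition lattice_set :: "(real ^ 2) set \<Rightarrow> bool" where
  "lattice_set S \<longleftrightarrow> finite S \<and> S \<noteq> {} \<and> (\<forall>x\<in>S. \<forall>i. x $ i \<in> \<int>)"

lemma lattice_polytope_iff: "lattice_polytope P \<longleftrightarrow> (\<exists>S. lattice_set S \<and> P = convex hull S)"
  by (auto simp: lattice_polytope_def lattice_set_def)

lemma compact_lattice_polytope: "lattice_set S \<Longrightarrow> compact (convex hull S)"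
  by (simp add: lattice_set_def finite_imp_compact_convex_hull)

lemma det2_lattice_Ints:
  assumes "lattice_set S" "lattice_set T" "x \<in> S" "y \<in> S" "b \<in> T" "t \<in> T"
  shows "det2 (y - x) (t - b) \<in> \<int>"
  using assms unfolding lattice_set_def det2_def by (auto intro!: Ints_diff Ints_mult)

lemma mixed_area_lattice_ge:
  assumes "lattice_set S" "lattice_set T" "x \<in> S" "y \<in> S" "b \<in> T" "t \<in> T"
    and "det2 (y - x) (t - b) \<noteq> 0"
  shows "\<bar>det2 (y - x) (t - b)\<bar> \<le> mixed_area (convex hull S) (convex hull T)"
proof -
  have "x \<noteq> y"
    using assms(7) by (auto simp: det2_simps)
  then show ?thesis
    using assms by (intro mixed_area_ge compact_lattice_polytope convex_convex_hull hull_inc) auto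
qed

text \<open>A linear functional on a convex hull takes its extrema at generators. This supplies
  lattice vectors of prescribed height over the segment.\<close>

lemma mixed_area_segment_attained:
  assumes T: "lattice_set T"
  obtains b t where "b \<in> T" "t \<in> T" "mixed_area (closed_segment x y) (convex hull T) = det2 (y - x) (t - b)"
proof -
  have "finite T" "T \<noteq> {}"
    using T by (auto simp: lattice_set_def)
  then obtain b t where bt: "b \<in> T" "t \<in> T"
    and *: "\<And>q. q \<in> T \<Longrightarrow> det2 (y - x) b \<le> det2 (y - x) q \<and> det2 (y - x) q \<le> det2 (y - x) t"
    using det2_extrema [of T "y - x"] finite_imp_compact by metis
  have "mixed_area (closed_segment x y) (convex hull T) = det2 (y - x) (t - b)"
    using bt det2_between_convex_hull [OF *]
    by (intro mixed_area_segment compact_lattice_polytope T convex_convex_hull hull_inc) auto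
  with bt that show thesis by blast
qed

section \<open>The case where one polygon of the pair with mixed area 1 is a segment\<close>

lemma lattice_set_segment:
  assumes "lattice_set S" "collinear S"
  obtains x y where "x \<in> S" "y \<in> S" "convex hull S = closed_segment x y"
proof -
  have "collinear (convex hull S)"
    using assms(2) collinear_affine_hull_collinear collinear_subset convex_hull_subset_affine_hull by metis
  moreover have "convex hull S \<noteq> {}"
    using assms(1) by (simp add: lattice_set_def)
  ultimately obtain x y where xy: "convex hull S = closed_segment x y"
    using compact_convex_collinear_segment compact_lattice_polytope [OF assms(1)] convex_convex_hull by metis
  \<comment> \<open>The end points of the segment are extreme points of the hull, hence generators
    and therefore lattice points.\<close>
  then have "x extreme_point_of convex hull S" "y extreme_point_of convex hull S"
    by (simp_all add: extreme_point_of_segment)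
  then have "x \<in> S" "y \<in> S"
    using extreme_point_of_convex_hull by blast+
  with xy that show thesis by blast
qed

text \<open>A nonzero value on a difference of points of \<open>T\<close> would be a multiple of
  \<open>N\<close>, hence at least \<open>N\<close> in absolute value, but the mixed area bounds it
  by \<open>r < N\<close>. So all of \<open>T\<close> lies on one level line.\<close>

lemma det2_constant_if_small_mixed_area:
  fixes N r :: int
  assumes S: "lattice_set S" "lattice_set T" and w: "w0 \<in> S" "w1 \<in> S"
    and dvd: "\<And>g h. g \<in> T \<Longrightarrow> h \<in> T \<Longrightarrow> \<exists>n. det2 (w1 - w0) (h - g) = of_int (N * n)"
    and v: "mixed_area (convex hull S) (convex hull T) = of_int r" and "r < N"
    and g: "g \<in> convex hull T" "t \<in> T"
  shows "det2 (w1 - w0) g = det2 (w1 - w0) t"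
proof -
  have "det2 (w1 - w0) (h - t) = 0" if h: "h \<in> T" for h
  proof (rule ccontr)
    assume ne: "det2 (w1 - w0) (h - t) \<noteq> 0"
    obtain n where n: "det2 (w1 - w0) (h - t) = of_int (N * n)"
      using dvd [OF g(2) h] by blast
    have "\<bar>det2 (w1 - w0) (h - t)\<bar> \<le> of_int r"
      using mixed_area_lattice_ge [OF S w g(2) h ne] v by simp
    then have "\<bar>N * n\<bar> \<le> r"
      unfolding n by linarith
    moreover have "N * n \<noteq> 0"
      using ne n by (metis of_int_0)
    then have "N \<le> \<bar>N * n\<bar>"
      using dvd_imp_le_int [of "N * n" N] by simp
    ultimately show False using \<open>r < N\<close> by simp
  qed
  then have *: "det2 (w1 - w0) t \<le> det2 (w1 - w0) h \<and> det2 (w1 - w0) h \<le> det2 (w1 - w0) t" if "h \<in> T" for h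
    using that by (simp add: det2_simps(4))
  then show ?thesis
    using det2_between_convex_hull [OF * g(1)] by simp
qed

lemma segment_configuration_impossible:
  fixes A B r :: int
  assumes S: "lattice_set S1" "lattice_set S2" "lattice_set S3" "lattice_set S4" and "collinear S1"
    and v: "mixed_area (convex hull S1) (convex hull S2) = 1"
      "mixed_area (convex hull S1) (convex hull S3) = of_int A"
      "mixed_area (convex hull S1) (convex hull S4) = of_int B"
      "mixed_area (convex hull S3) (convex hull S4) = of_int r"
    and AB: "A > 0" "B > 0" and r: "0 < r" "r < A div gcd A B" "r < B div gcd A B" "r < gcd A B"
  shows False
proof -
  obtain x y where xy: "x \<in> S1" "y \<in> S1" and P1: "convex hull S1 = closed_segment x y"
    using lattice_set_segment [OF S(1) \<open>collinear S1\<close>] .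
  define u where "u = y - x"
  \<comment> \<open>The mixed area 1 provides a vector \<open>f\<close> that completes
    \<open>u\<close> to a basis of determinant 1; the coordinates of \<open>Z\<close> and
    \<open>W\<close> in it are integers.\<close>
  obtain f0 f1 where f01: "f0 \<in> S2" "f1 \<in> S2" "det2 u (f1 - f0) = 1"
    using mixed_area_segment_attained [OF S(2), of x y] v(1) unfolding P1 u_def by metis
  obtain z0 z1 where z01: "z0 \<in> S3" "z1 \<in> S3" "det2 u (z1 - z0) = of_int A"
    using mixed_area_segment_attained [OF S(3), of x y] v(2) unfolding P1 u_def by metis
  obtain w0 w1 where w01: "w0 \<in> S4" "w1 \<in> S4" "det2 u (w1 - w0) = of_int B"
    using mixed_area_segment_attained [OF S(4), of x y] v(3) unfolding P1 u_def by metis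
  define f where "f = f1 - f0"
  define Z where "Z = z1 - z0"
  define W where "W = w1 - w0"
  have uf: "det2 u f = 1" using f01 by (simp add: f_def)
  have expand: "g = det2 g f *\<^sub>R u + det2 u g *\<^sub>R f" for g
    using det2_expand [of u f g] uf by simp
  obtain p where p: "det2 Z f = of_int p"
    using det2_lattice_Ints [OF S(3,2) z01(1,2) f01(1,2)] by (auto simp: Z_def f_def elim: Ints_cases)
  obtain q where q: "det2 W f = of_int q"
    using det2_lattice_Ints [OF S(4,2) w01(1,2) f01(1,2)] by (auto simp: W_def f_def elim: Ints_cases)
  have Z: "Z = of_int p *\<^sub>R u + of_int A *\<^sub>R f" and W: "W = of_int q *\<^sub>R u + of_int B *\<^sub>R f"
    using expand [of Z] expand [of W] z01(3) w01(3) p q by (simp_all add: Z_def W_def)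
  have ZW: "det2 Z W = of_int (p * B - A * q)"
    using uf det2_swap [of f u] by (simp add: Z W det2_simps algebra_simps)
  define D where "D = gcd A B"
  have D: "D > 0" using AB by (simp add: D_def)
  obtain A' B' where AB': "A = D * A'" "B = D * B'" and "coprime A' B'"
    using gcd_coprime_exists [of A B] D AB by (metis D_def mult.commute order_less_irrefl)
  have div: "A div D = A'" "B div D = B'" using AB' D by auto
  have "p * B = A * q"
  proof (rule ccontr)
    assume ne: "p * B \<noteq> A * q"
    then have "det2 Z W \<noteq> 0"
      unfolding ZW by (subst of_int_eq_0_iff) simp
    then have "\<bar>det2 Z W\<bar> \<le> of_int r"
      using mixed_area_lattice_ge [OF S(3,4) z01(1,2) w01(1,2)] v(4) by (simp add: Z_def W_def)
    then have "\<bar>p * B - A * q\<bar> \<le> r"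
      unfolding ZW by linarith
    moreover have "D dvd p * B - A * q"
      by (simp add: AB')
    then have "D \<le> \<bar>p * B - A * q\<bar>"
      using ne dvd_imp_le_int [of "p * B - A * q" D] by simp
    ultimately show False
      using r(4) by (simp add: D_def)
  qed
  then have pq: "p * B' = A' * q"
    using D by (simp add: AB')
  \<comment> \<open>By coprimality \<open>Z\<close> is \<open>A'\<close> times, and \<open>W\<close>
    is \<open>B'\<close> times, an integer combination of \<open>u\<close> and
    \<open>f\<close>.\<close>
  have "A' dvd p" "B' dvd q"
    using \<open>coprime A' B'\<close> pq
    by (metis coprime_dvd_mult_left_iff dvd_triv_left,
        metis coprime_commute coprime_dvd_mult_right_iff dvd_triv_right)
  then obtain p' q' where p': "p = A' * p'" and q': "q = B' * q'"
    by (auto elim!: dvdE)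
  have A'B': "r < A'" "r < B'" using r div by (simp_all add: D_def)
  \<comment> \<open>The vector is \<open>N\<close> times \<open>m u + D f\<close>. It equals
    \<open>Z\<close> for \<open>N = A'\<close>, \<open>m = p'\<close>, and \<open>W\<close> for
    \<open>N = B'\<close>, \<open>m = q'\<close>.\<close>
  have multiple: "\<exists>n. det2 (of_int (N * m) *\<^sub>R u + of_int (D * N) *\<^sub>R f) (h - g) = of_int (N * n)"
    if T: "lattice_set T" "g \<in> T" "h \<in> T" for T g h and N m :: int
  proof -
    obtain k where k: "det2 u (h - g) = of_int k"
      using det2_lattice_Ints [OF S(1) T(1) xy T(2,3)] by (auto simp: u_def elim: Ints_cases)
    obtain l where l: "det2 f (h - g) = of_int l"
      using det2_lattice_Ints [OF S(2) T(1) f01(1,2) T(2,3)] by (auto simp: f_def elim: Ints_cases)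
    have "det2 (of_int (N * m) *\<^sub>R u + of_int (D * N) *\<^sub>R f) (h - g) = of_int (N * (m * k + D * l))"
      by (simp add: det2_simps(1,5) k l algebra_simps)
    then show ?thesis ..
  qed
  have "real_of_int A' *\<^sub>R W = real_of_int (p * B') *\<^sub>R u + real_of_int (B' * A) *\<^sub>R f"
    unfolding W pq by (simp add: AB' scaleR_add_right mult_ac)
  also have "\<dots> = real_of_int B' *\<^sub>R Z"
    unfolding Z by (simp add: scaleR_add_right mult_ac)
  finally have parallel: "real_of_int A' *\<^sub>R W = real_of_int B' *\<^sub>R Z" .
  have line3: "det2 W g = det2 W z0" if "g \<in> convex hull S3" for g
    unfolding W_def
  proof (rule det2_constant_if_small_mixed_area [OF S(4,3) w01(1,2) _ _ A'B'(2) that z01(1)])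
    show "mixed_area (convex hull S4) (convex hull S3) = of_int r"
      using v(4) by (simp only: mixed_area_commute)
    show "\<exists>n. det2 (w1 - w0) (h - g) = of_int (B' * n)" if "g \<in> S3" "h \<in> S3" for g h
      using multiple [OF S(3) that, of B' q'] W by (simp only: W_def q' AB')
  qed
  have line4: "det2 W g = det2 W w0" if "g \<in> convex hull S4" for g
  proof -
    have "det2 Z g = det2 Z w0"
      unfolding Z_def
    proof (rule det2_constant_if_small_mixed_area [OF S(3,4) z01(1,2) _ v(4) A'B'(1) that w01(1)])
      show "\<exists>n. det2 (z1 - z0) (h - g) = of_int (A' * n)" if "g \<in> S4" "h \<in> S4" for g h
        using multiple [OF S(4) that, of A' p'] Z by (simp only: Z_def p' AB')
    qed
    \<comment> \<open>\<open>mixed_area_parallel\<close> asks for one direction common to both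
      polygons, so the level line of \<open>Z\<close> is turned into one of
      \<open>W\<close>.\<close>
    then have "det2 (real_of_int A' *\<^sub>R W) g = det2 (real_of_int A' *\<^sub>R W) w0"
      unfolding parallel by (simp add: det2_simps)
    then show ?thesis using A'B' r(1) by (simp add: det2_simps)
  qed
  have "W \<noteq> 0"
    using w01(3) AB by (auto simp: W_def det2_simps)
  then have "mixed_area (convex hull S3) (convex hull S4) = 0"
    using line3 line4 by (intro mixed_area_parallel) auto
  with v(4) r(1) show False by simp
qed

subsection \<open>Pairs of polygons with mixed area 1\<close>

text \<open>If every determinant vanished, \<open>S\<close> would lie on the line through
  \<open>x\<close> and \<open>y\<close>. Exchanging \<open>y\<close> and \<open>z\<close> makes the
  orientation positive.\<close>

lemma not_collinear_triangle:
  assumes "\<not> collinear S"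
  obtains x y z where "x \<in> S" "y \<in> S" "z \<in> S" "det2 (y - x) (z - x) > 0"
proof -
  obtain x y where xy: "x \<in> S" "y \<in> S" "x \<noteq> y"
    using assms collinear_def by (metis right_minus_eq scaleR_zero_left)
  have "\<exists>z\<in>S. det2 (y - x) (z - x) \<noteq> 0"
  proof (rule ccontr)
    assume *: "\<not> ?thesis"
    have "S \<subseteq> affine hull {x, y}"
    proof
      fix z assume "z \<in> S"
      with * have 0: "(y - x) $ 1 * (z - x) $ 2 = (y - x) $ 2 * (z - x) $ 1"
        by (auto simp: det2_def)
      have "\<exists>c. z - x = c *\<^sub>R (y - x)"
      proof (cases "(y - x) $ 1 = 0")
        case True
        then have "(y - x) $ 2 \<noteq> 0" using xy(3) by (auto simp: vec_eq_iff forall_2)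
        then show ?thesis using 0 True
          by (intro exI [of _ "(z - x) $ 2 / (y - x) $ 2"])
            (auto simp: vec_eq_iff forall_2 simp del: vector_minus_component)
      next
        case False
        then show ?thesis using 0
          by (intro exI [of _ "(z - x) $ 1 / (y - x) $ 1"])
            (auto simp: vec_eq_iff forall_2 eq_divide_eq mult.commute simp del: vector_minus_component)
      qed
      then obtain c where "z = (1 - c) *\<^sub>R x + c *\<^sub>R y"
        by (auto simp: algebra_simps)
      then show "z \<in> affine hull {x, y}"
        unfolding affine_hull_2 by force
    qed
    then have "collinear S"
      using collinear_affine_hull by blast
    with assms show False ..
  qed
  then obtain z where z: "z \<in> S" "det2 (y - x) (z - x) \<noteq> 0" by blast
  show thesis
  proof (cases "det2 (y - x) (z - x) > 0")
    case True
    then show thesis using that xy z by blast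
  next
    case False
    then show thesis using that [of x z y] xy z det2_swap [of "z - x" "y - x"] by auto
  qed
qed

lemma Ints_le_1:
  fixes a :: real
  assumes "a \<in> \<int>" "\<bar>a\<bar> \<le> 1" shows "a = -1 \<or> a = 0 \<or> a = 1"
proof -
  obtain n where "a = of_int n" using assms(1) by (rule Ints_cases)
  then show ?thesis using assms(2) by auto
qed

text \<open>The six pairs are the positively oriented edge pairs at the three vertices of the
  triangle \<open>0, e1, e2\<close> and of its reflection \<open>0, -e1, -e2\<close>. So a triangle
  with edges \<open>f1\<close>, \<open>f2\<close> is a translate of one of these two.\<close>

lemma unimodular_hexagon:
  fixes e1 e2 f1 f2 :: "real ^ 2"
  assumes pos: "det2 e1 e2 > 0" "det2 f1 f2 > 0"
    and *: "\<And>e f. e \<in> {e1, e2, e1 - e2} \<Longrightarrow> f \<in> {f1, f2, f1 - f2} \<Longrightarrow>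
      det2 e f = -1 \<or> det2 e f = 0 \<or> det2 e f = 1"
    and int: "det2 e1 e2 \<in> \<int>" "det2 f1 f2 \<in> \<int>"
  shows "det2 e1 e2 = 1"
    and "(f1, f2) \<in> {(e1, e2), (- e1, - e2), (e2 - e1, - e1), (e1 - e2, e1), (e2, e2 - e1), (- e2, e1 - e2)}"
proof -
  obtain m n :: int where mn: "det2 e1 e2 = m" "det2 f1 f2 = n"
    using int by (auto elim!: Ints_cases)
  define a b c d where "a = det2 e1 f1" and "b = det2 e1 f2" and "c = det2 e2 f1" and "d = det2 e2 f2"
  \<comment> \<open>Multiplicativity of the determinant: \<open>a\<close>, \<open>b\<close>,
    \<open>c\<close>, \<open>d\<close> are the entries of the matrix pairing \<open>e1\<close>,
    \<open>e2\<close> with \<open>f1\<close>, \<open>f2\<close>.\<close>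
  have eq: "det2 e1 e2 * det2 f1 f2 = a * d - b * c"
    by (simp add: a_def b_def c_def d_def det2_def algebra_simps)
  have abcd: "a = -1 \<or> a = 0 \<or> a = 1" "b = -1 \<or> b = 0 \<or> b = 1" "c = -1 \<or> c = 0 \<or> c = 1" "d = -1 \<or> d = 0 \<or> d = 1"
    using *[of e1 f1] *[of e1 f2] *[of e2 f1] *[of e2 f2]
    unfolding a_def b_def c_def d_def by simp_all
  have abs_le: "\<bar>t\<bar> \<le> 1" if "t = -1 \<or> t = 0 \<or> t = 1" for t :: real
    using that by auto
  have diffs: "\<bar>a - b\<bar> \<le> 1" "\<bar>c - d\<bar> \<le> 1" "\<bar>a - c\<bar> \<le> 1" "\<bar>b - d\<bar> \<le> 1" "\<bar>(a - c) - (b - d)\<bar> \<le> 1"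
    using abs_le [OF *[of e1 "f1 - f2"]] abs_le [OF *[of e2 "f1 - f2"]]
      abs_le [OF *[of "e1 - e2" f1]] abs_le [OF *[of "e1 - e2" f2]] abs_le [OF *[of "e1 - e2" "f1 - f2"]]
    unfolding a_def b_def c_def d_def by (simp_all add: det2_simps)
  have ad: "a * d - b * c > 0"
    using pos eq by (metis mult_pos_pos)
  \<comment> \<open>Of the 81 matrices with entries -1, 0, 1, the bounds on row and column
    differences and the positive determinant leave six, all of determinant 1.\<close>
  have cases: "(a, b, c, d) \<in> {(0,1,-1,0), (0,-1,1,0), (1,0,1,1), (-1,0,-1,-1), (1,1,0,1), (-1,-1,0,-1)}"
    using abcd by (elim disjE; insert diffs ad; simp)
  then have "a * d - b * c = 1" by auto
  then have "m * n = 1" using eq mn by (metis of_int_eq_1_iff of_int_mult)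
  moreover have "m > 0" using pos mn by simp
  ultimately have "m = 1" by (auto simp: zmult_eq_1_iff)
  then show one: "det2 e1 e2 = 1" using mn by simp
  have f1: "f1 = (- c) *\<^sub>R e1 + a *\<^sub>R e2" and f2: "f2 = (- d) *\<^sub>R e1 + b *\<^sub>R e2"
    using det2_expand [of e1 e2 f1] det2_expand [of e1 e2 f2] det2_swap [of _ e2] one
    by (simp_all add: a_def b_def c_def d_def)
  show "(f1, f2) \<in> {(e1, e2), (- e1, - e2), (e2 - e1, - e1), (e1 - e2, e1), (e2, e2 - e1), (- e2, e1 - e2)}"
    using cases unfolding f1 f2 by (elim insertE emptyE) simp_all
qed

text \<open>The coordinates of \<open>g\<close> in the basis \<open>e1\<close>, \<open>e2\<close>
  are integers, and the bounds make them nonnegative with sum at most 1. This excludes generators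
  other than the three vertices.\<close>

lemma unimodular_triangle_points:
  assumes one: "det2 e1 e2 = 1"
    and g: "\<bar>det2 g e1\<bar> \<le> 1" "\<bar>det2 g e2\<bar> \<le> 1" "\<bar>det2 g (e1 - e2)\<bar> \<le> 1"
      "\<bar>det2 (g - e1) e2\<bar> \<le> 1" "\<bar>det2 (g - e2) e1\<bar> \<le> 1"
    and int: "det2 g e1 \<in> \<int>" "det2 g e2 \<in> \<int>"
  shows "g \<in> {0, e1, e2}"
proof -
  have swap: "det2 e2 e1 = -1" using one det2_swap [of e2 e1] by simp
  have "(det2 g e1, det2 g e2) \<in> {(0, 0), (0, 1), (-1, 0)}"
    using Ints_le_1 [OF int(1) g(1)] Ints_le_1 [OF int(2) g(2)]
    by (elim disjE; insert g [unfolded det2_simps one swap abs_le_iff]; simp)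
  moreover have "g = det2 g e2 *\<^sub>R e1 - det2 g e1 *\<^sub>R e2"
    using det2_expand [of e1 e2 g] one det2_swap [of e1 g] by simp
  ultimately show ?thesis
    by auto
qed

text \<open>Up to translation, the zonotope below is the sum of the triangle with vertices
  \<open>0, e1, e2\<close> and its reflection.\<close>

lemma measure_hexagon:
  assumes one: "det2 e1 e2 = 1"
  shows "measure lebesgue ((closed_segment 0 e1 + closed_segment 0 e2) + closed_segment 0 (e2 - e1)) = 3"
proof -
  let ?Q = "closed_segment 0 e1 + closed_segment 0 e2"
  have swap: "det2 e2 e1 = -1" using one det2_swap [of e2 e1] by simp
  have "measure lebesgue (closed_segment 0 e1) = 0"
    using measure_plus_segment [of "{0}" 0 0 e1] by (simp add: det2_simps)
  \<comment> \<open>The successive segments add the widths 1 and 2. The determinants are negative on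
    \<open>e1\<close> and on \<open>e1 + e2\<close>, so \<open>0\<close> is the highest point both
    times.\<close>
  moreover have "measure lebesgue ?Q = measure lebesgue (closed_segment 0 e1) + det2 e2 (0 - e1)"
    by (rule measure_plus_segment) (auto simp: in_segment det2_simps swap)
  moreover have "measure lebesgue (?Q + closed_segment 0 (e2 - e1)) = measure lebesgue ?Q + det2 (e2 - e1) (0 - (e1 + e2))"
  proof (rule measure_plus_segment)
    show "compact ?Q" by (intro compact_set_plus compact_segment)
    show "convex ?Q" by (intro convex_set_plus convex_closed_segment)
    show "e1 + e2 \<in> ?Q" by (intro set_plus_intro) auto
    have "0 + 0 \<in> ?Q" by (intro set_plus_intro) auto
    then show "0 \<in> ?Q" by simp
    show "det2 (e2 - e1) (e1 + e2) \<le> det2 (e2 - e1) q \<and> det2 (e2 - e1) q \<le> det2 (e2 - e1) 0"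
      if "q \<in> ?Q" for q
      using that by (auto simp: set_plus_def in_segment det2_simps swap one)
  qed
  ultimately show ?thesis
    by (simp add: det2_simps one swap)
qed

text \<open>The sum contains a translate of the hexagon of area 3, and each triangle has area
  1/2.\<close>

lemma mixed_area_opposite_triangles:
  assumes one: "det2 e1 e2 = 1"
  shows "mixed_area (convex hull {x, x + e1, x + e2}) (convex hull {y, y - e1, y - e2}) \<ge> 2"
proof -
  let ?P = "convex hull {x, x + e1, x + e2}" and ?Q = "convex hull {y, y - e1, y - e2}"
  \<comment> \<open>The vertex \<open>0\<close> of the zonotope is sent to
    \<open>x + (y - e2)\<close>. With this shift each of the eight sums of segment ends is a vertex
    of one triangle plus a vertex of the other.\<close>
  let ?c = "x + y - e2"
  let ?H = "(closed_segment 0 e1 + closed_segment 0 e2) + closed_segment 0 (e2 - e1)"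
  have leb: "measure lebesgue (convex hull A) = measure lborel (convex hull A)"
    if "finite A" for A :: "(real ^ 2) set"
    using that by (intro measure_completion) (simp add: borel_compact finite_imp_compact_convex_hull)
  have P: "measure lebesgue ?P = 1 / 2" and Q: "measure lebesgue ?Q = 1 / 2"
    using one by (simp_all add: leb content_triangle det2_def algebra_simps)
  have H: "?H = convex hull (({0, e1} + {0, e2}) + {0, e2 - e1})"
    by (simp only: convex_hull_set_plus segment_convex_hull)
  have PQ: "?P + ?Q = convex hull ({x, x + e1, x + e2} + {y, y - e1, y - e2})"
    by (simp only: convex_hull_set_plus)
  have "(+) ?c ` ?H = convex hull ((+) ?c ` (({0, e1} + {0, e2}) + {0, e2 - e1}))"
    unfolding H by (simp only: convex_hull_translation)
  also have "\<dots> \<subseteq> ?P + ?Q"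
    unfolding PQ
  proof (rule hull_mono, rule subsetI)
    fix w assume "w \<in> (+) ?c ` ({0, e1} + {0, e2} + {0, e2 - e1})"
    then obtain i j k where w: "w = ?c + (i + j + k)" and "i \<in> {0, e1}" "j \<in> {0, e2}" "k \<in> {0, e2 - e1}"
      by (auto elim!: set_plus_elim)
    have sum: "w \<in> {x, x + e1, x + e2} + {y, y - e1, y - e2}"
      if "w = p + q" "p \<in> {x, x + e1, x + e2}" "q \<in> {y, y - e1, y - e2}" for p q
      using that by (simp only: set_plus_intro)
    show "w \<in> {x, x + e1, x + e2} + {y, y - e1, y - e2}"
      using \<open>i \<in> {0, e1}\<close> \<open>j \<in> {0, e2}\<close> \<open>k \<in> {0, e2 - e1}\<close>
    proof (elim insertE emptyE)
      show ?thesis if "i = 0" "j = 0" "k = 0"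
        using w that by (intro sum [of "x" "y - e2"]) simp_all
      show ?thesis if "i = e1" "j = 0" "k = 0"
        using w that by (intro sum [of "x + e1" "y - e2"]) simp_all
      show ?thesis if "i = 0" "j = e2" "k = 0"
        using w that by (intro sum [of "x" "y"]) simp_all
      show ?thesis if "i = e1" "j = e2" "k = 0"
        using w that by (intro sum [of "x + e1" "y"]) simp_all
      show ?thesis if "i = 0" "j = 0" "k = e2 - e1"
        using w that by (intro sum [of "x" "y - e1"]) simp_all
      show ?thesis if "i = e1" "j = 0" "k = e2 - e1"
        using w that by (intro sum [of "x" "y"]) simp_all
      show ?thesis if "i = 0" "j = e2" "k = e2 - e1"
        using w that by (intro sum [of "x + e2" "y - e1"]) simp_all
      show ?thesis if "i = e1" "j = e2" "k = e2 - e1"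
        using w that by (intro sum [of "x + e2" "y"]) simp_all
    qed
  qed
  finally have "measure lebesgue ((+) ?c ` ?H) \<le> measure lebesgue (?P + ?Q)"
    by (intro measure_mono_fmeasurable fmeasurableD measurable_translation lmeasurable_compact
        compact_set_plus compact_segment finite_imp_compact_convex_hull) auto
  then show ?thesis
    using P Q unfolding measure_translation measure_hexagon [OF one] mixed_area_alt by simp
qed

text \<open>All determinants between differences in \<open>S\<close> and in \<open>T\<close> lie in
  {-1, 0, 1}. This makes both sets the vertices of unimodular triangles that agree up to translation
  and a sign \<sigma>; mixed area 1 then excludes the sign -1.\<close>

lemma mixed_area_1_translate:
  assumes S: "lattice_set S" "lattice_set T" and "\<not> collinear S" "\<not> collinear T"
    and v: "mixed_area (convex hull S) (convex hull T) = 1"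
  obtains p where "convex hull T = (+) p ` (convex hull S)"
proof -
  have le: "\<bar>det2 (y - x) (t - b)\<bar> \<le> 1" if "x \<in> S" "y \<in> S" "b \<in> T" "t \<in> T" for x y b t
    using mixed_area_lattice_ge [OF S that] v by (cases "det2 (y - x) (t - b) = 0") auto
  note int = det2_lattice_Ints [OF S]
  have val: "det2 (y - x) (t - b) = -1 \<or> det2 (y - x) (t - b) = 0 \<or> det2 (y - x) (t - b) = 1"
    if "x \<in> S" "y \<in> S" "b \<in> T" "t \<in> T" for x y b t
    using Ints_le_1 [OF int le] that by blast
  obtain x y z where xyz: "x \<in> S" "y \<in> S" "z \<in> S" "det2 (y - x) (z - x) > 0"
    using not_collinear_triangle [OF assms(3)] .
  obtain x' y' z' where xyz': "x' \<in> T" "y' \<in> T" "z' \<in> T" "det2 (y' - x') (z' - x') > 0"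
    using not_collinear_triangle [OF assms(4)] .
  define e1 e2 where e: "e1 = y - x" "e2 = z - x"
  define f1 f2 where f: "f1 = y' - x'" "f2 = z' - x'"
  have diff: "det2 e f = -1 \<or> det2 e f = 0 \<or> det2 e f = 1"
    if "e \<in> {e1, e2, e1 - e2}" "f \<in> {f1, f2, f1 - f2}" for e f
    using that xyz xyz' val [of x y] val [of x z] val [of z y]
    by (elim insertE emptyE) (simp_all add: e f)
  have ints: "det2 e1 e2 \<in> \<int>" "det2 f1 f2 \<in> \<int>"
    using det2_lattice_Ints [OF S(1) S(1)] det2_lattice_Ints [OF S(2) S(2)] xyz xyz' by (auto simp: e f)
  have pos: "det2 e1 e2 > 0" "det2 f1 f2 > 0"
    using xyz(4) xyz'(4) by (simp_all add: e f)
  note hex = unimodular_hexagon [OF pos diff ints]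
  have one: "det2 e1 e2 = 1"
    by (rule hex(1))
  have T: "x' \<in> T" "x' + f1 \<in> T" "x' + f2 \<in> T"
    using xyz' by (simp_all add: f)
  \<comment> \<open>Choosing the right vertex of the triangle in \<open>T\<close> as base point
    \<open>b\<close> reduces the six cases to a sign.\<close>
  obtain \<sigma> b where \<sigma>: "\<sigma> \<in> {1, -1}" and b: "b \<in> T" "b + \<sigma> *\<^sub>R e1 \<in> T" "b + \<sigma> *\<^sub>R e2 \<in> T"
  proof -
    consider "f1 = e1" "f2 = e2" | "f1 = - e1" "f2 = - e2" | "f1 = e2 - e1" "f2 = - e1"
      | "f1 = e1 - e2" "f2 = e1" | "f1 = e2" "f2 = e2 - e1" | "f1 = - e2" "f2 = e1 - e2"
      using hex(2) by blast
    then show thesis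
    proof cases
      case 1 then show ?thesis using that [of 1 x'] T by simp
    next
      case 2 then show ?thesis using that [of "-1" x'] T by simp
    next
      case 3 show ?thesis using that [of 1 "x' + f2"] T unfolding 3 by (simp add: algebra_simps)
    next
      case 4 show ?thesis using that [of "-1" "x' + f2"] T unfolding 4 by (simp add: algebra_simps)
    next
      case 5 show ?thesis using that [of "-1" "x' + f1"] T unfolding 5 by (simp add: algebra_simps)
    next
      case 6 show ?thesis using that [of 1 "x' + f1"] T unfolding 6 by (simp add: algebra_simps)
    qed
  qed
  have Sxyz: "x \<in> S" "x + e1 \<in> S" "x + e2 \<in> S" using xyz by (simp_all add: e)
  have edges_S: "\<exists>p\<in>S. \<exists>q\<in>S. q - p = h" if "h \<in> {e1, e2, e1 - e2}" for h
    using that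
  proof (elim insertE emptyE)
    show ?thesis if "h = e1" using Sxyz that by (intro bexI [of _ x] bexI [of _ "x + e1"]) auto
    show ?thesis if "h = e2" using Sxyz that by (intro bexI [of _ x] bexI [of _ "x + e2"]) auto
    show ?thesis if "h = e1 - e2" using Sxyz that by (intro bexI [of _ "x + e2"] bexI [of _ "x + e1"]) auto
  qed
  have S_bound: "\<bar>det2 h (w - q)\<bar> \<le> 1 \<and> det2 h (w - q) \<in> \<int>"
    if qw: "h \<in> {e1, e2, e1 - e2}" "q \<in> T" "w \<in> T" for h q w
  proof -
    obtain p p' where "p \<in> S" "p' \<in> S" "p' - p = h"
      using edges_S [OF qw(1)] by blast
    then show ?thesis
      using le [of p p' q w] int [of p p' q w] qw by simp
  qed
  have edges_T: "\<exists>p\<in>T. \<exists>q\<in>T. q - p = \<sigma> *\<^sub>R h" if "h \<in> {e1, e2, e1 - e2}" for h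
    using that
  proof (elim insertE emptyE)
    show ?thesis if "h = e1" using b that
      by (intro bexI [of _ b] bexI [of _ "b + \<sigma> *\<^sub>R e1"]) auto
    show ?thesis if "h = e2" using b that
      by (intro bexI [of _ b] bexI [of _ "b + \<sigma> *\<^sub>R e2"]) auto
    show ?thesis if "h = e1 - e2" using b that
      by (intro bexI [of _ "b + \<sigma> *\<^sub>R e2"] bexI [of _ "b + \<sigma> *\<^sub>R e1"]) (auto simp: scaleR_diff_right)
  qed
  \<comment> \<open>Since the chosen triangles have the same edges up to \<sigma>, the edges of each
    one constrain all points of the other set, and hence points of its own set against its own
    edges.\<close>
  have T_bound: "\<bar>det2 (w - q) (\<sigma> *\<^sub>R h)\<bar> \<le> 1 \<and> det2 (w - q) (\<sigma> *\<^sub>R h) \<in> \<int>"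
    if qw: "h \<in> {e1, e2, e1 - e2}" "q \<in> S" "w \<in> S" for h q w
  proof -
    obtain p p' where "p \<in> T" "p' \<in> T" "p' - p = \<sigma> *\<^sub>R h"
      using edges_T [OF qw(1)] by blast
    then show ?thesis
      using le [of q w p p'] int [of q w p p'] qw by simp
  qed
  have scale: "(\<bar>\<sigma> * t\<bar> \<le> 1 \<and> \<sigma> * t \<in> \<int>) = (\<bar>t\<bar> \<le> 1 \<and> t \<in> \<int>)" for t
    using \<sigma> by auto
  have S_eq: "S = {x, x + e1, x + e2}"
  proof (intro subset_antisym subsetI)
    fix w assume w: "w \<in> S"
    have *: "\<bar>det2 (w - q) h\<bar> \<le> 1 \<and> det2 (w - q) h \<in> \<int>" if "q \<in> S" "h \<in> {e1, e2, e1 - e2}" for q h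
      using T_bound [OF that(2,1) w] by (simp only: det2_simps(6) scale)
    have "w - x \<in> {0, e1, e2}"
      using *[OF Sxyz(1)] *[OF Sxyz(2)] *[OF Sxyz(3)]
      by (intro unimodular_triangle_points one) (simp_all add: diff_diff_eq)
    then show "w \<in> {x, x + e1, x + e2}"
      by (auto simp: algebra_simps)
  qed (use Sxyz in auto)
  have T_eq: "T = {b, b + \<sigma> *\<^sub>R e1, b + \<sigma> *\<^sub>R e2}"
  proof (intro subset_antisym subsetI)
    fix w assume w: "w \<in> T"
    \<comment> \<open>Multiplying by \<sigma> brings \<open>T\<close> into the position of the
      triangle \<open>0, e1, e2\<close>; a second multiplication undoes this.\<close>
    have *: "\<bar>det2 (\<sigma> *\<^sub>R (w - q)) h\<bar> \<le> 1 \<and> det2 (\<sigma> *\<^sub>R (w - q)) h \<in> \<int>" if "q \<in> T" "h \<in> {e1, e2, e1 - e2}" for q h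
      using S_bound [OF that(2,1) w] by (simp only: det2_simps(5) scale det2_swap [of "w - q" h] abs_minus_cancel minus_in_Ints_iff)
    have shift: "\<sigma> *\<^sub>R (w - (b + \<sigma> *\<^sub>R h)) = \<sigma> *\<^sub>R (w - b) - h" for h
      using \<sigma> by (auto simp: scaleR_diff_right scaleR_add_right)
    have "\<sigma> *\<^sub>R (w - b) \<in> {0, e1, e2}"
      using *[OF b(1)] *[OF b(2)] *[OF b(3)]
      by (intro unimodular_triangle_points one) (simp_all only: shift insertI1 insertI2)
    moreover have "w = b + \<sigma> *\<^sub>R (\<sigma> *\<^sub>R (w - b))"
      using \<sigma> by auto
    ultimately show "w \<in> {b, b + \<sigma> *\<^sub>R e1, b + \<sigma> *\<^sub>R e2}"
      by (metis insert_iff scaleR_zero_right add.right_neutral singletonD)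
  qed (use b in auto)
  have "\<sigma> = 1"
  proof (rule ccontr)
    assume "\<sigma> \<noteq> 1"
    then have "T = {b, b - e1, b - e2}" using \<sigma> T_eq by auto
    then show False
      using mixed_area_opposite_triangles [OF one, of x b] v S_eq by simp
  qed
  then have "T = (+) (b - x) ` S"
    unfolding T_eq S_eq by simp
  then show thesis
    using that [of "b - x"] by (simp add: convex_hull_translation)
qed

section \<open>Verification of the interior point and exclusion of every realization\<close>

theorem theorem8p1:
  fixes a b c d r :: int and v :: "nat \<Rightarrow> nat \<Rightarrow> real"
  assumes "a > 0" and "b > 0"
    and "d = gcd a b" and "d > 1"
    and "c > 1"
    and "0 < r" and "r < Min {a div d, b div d, d}"
    and "v 1 2 = 1" and "v 1 3 = of_int a" and "v 1 4 = of_int b"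
    and "v 2 3 = of_int (a * c)" and "v 2 4 = of_int (b * c)" and "v 3 4 = of_int r"
  shows "v \<in> Pl42_Z_interior \<and> v \<notin> Vsf42_Z"
proof
  have r: "r < a div gcd a b" "r < b div gcd a b" "r < gcd a b"
    using assms(3,7) by auto
  have pairs: "(i, j) \<in> {(1,2), (1,3), (1,4), (2,3), (2,4), (3,4)}"
    if "1 \<le> i" "i < j" "j \<le> 4" for i j :: nat
  proof -
    have "i = 1 \<or> i = 2 \<or> i = 3" "j = 2 \<or> j = 3 \<or> j = 4"
      using that by linarith+
    then show ?thesis using that(2) by auto
  qed
  show "v \<in> Pl42_Z_interior"
  proof -
    \<comment> \<open>The products \<open>v 1 3 * v 2 4\<close> and \<open>v 1 4 * v 2 3\<close>
      both equal \<open>a * b * c\<close>, and \<open>v 1 2 * v 3 4 = r\<close>. So being interior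
      amounts to \<open>0 < r < 2 * (a * (b * c))\<close>.\<close>
    have "r < a"
      using r(3) gcd_le1_int [of a b] assms(1) by linarith
    moreover have "a * 1 \<le> a * (b * c)"
      using assms(1,2,5) by (intro mult_left_mono) (auto simp: int_one_le_iff_zero_less)
    ultimately have "r < 2 * (a * (b * c))"
      using assms(1) by linarith
    then have "real_of_int r < real_of_int (2 * (a * (b * c)))"
      by (simp only: of_int_less_iff)
    then have rle: "real_of_int r < 2 * (a * (b * c))" by simp
    have "v i j \<in> \<int> \<and> v i j \<ge> 0" if "1 \<le> i" "i < j" "j \<le> 4" for i j
      using pairs [OF that] assms by auto
    then show ?thesis
      using assms(6,8-) rle unfolding Pl42_Z_interior_def Pl42_Z_boundary_def Pl42_Z_def
      by (auto simp: algebra_simps)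
  qed
  show "v \<notin> Vsf42_Z"
  proof
    assume "v \<in> Vsf42_Z"
    then obtain P where lp: "\<And>i. 1 \<le> i \<Longrightarrow> i \<le> 4 \<Longrightarrow> lattice_polytope (P i)"
      and vP: "\<And>i j. 1 \<le> i \<Longrightarrow> i < j \<Longrightarrow> j \<le> 4 \<Longrightarrow> v i j = mixed_area (P i) (P j)"
      unfolding Vsf42_Z_def by blast
    obtain S1 S2 S3 S4 where S: "lattice_set S1" "lattice_set S2" "lattice_set S3" "lattice_set S4"
      and P: "P 1 = convex hull S1" "P 2 = convex hull S2" "P 3 = convex hull S3" "P 4 = convex hull S4"
      using lp [of 1] lp [of 2] lp [of 3] lp [of 4] by (auto simp: lattice_polytope_iff)
    have m: "mixed_area (convex hull S1) (convex hull S2) = 1"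
      "mixed_area (convex hull S1) (convex hull S3) = of_int a"
      "mixed_area (convex hull S1) (convex hull S4) = of_int b"
      "mixed_area (convex hull S2) (convex hull S3) = of_int (a * c)"
      "mixed_area (convex hull S2) (convex hull S4) = of_int (b * c)"
      "mixed_area (convex hull S3) (convex hull S4) = of_int r"
      using vP [of 1 2] vP [of 1 3] vP [of 1 4] vP [of 2 3] vP [of 2 4] vP [of 3 4] assms(8-13)
      by (simp_all add: P del: One_nat_def)
    have "\<not> collinear S1"
      using segment_configuration_impossible [OF S] m assms(1,2,6) r by blast
    moreover have "\<not> collinear S2"
    proof
      assume col: "collinear S2"
      \<comment> \<open>With \<open>S1\<close> and \<open>S2\<close> exchanged, \<open>a\<close> and
        \<open>b\<close> are replaced by their multiples by \<open>c\<close>. The quotients by the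
        gcd stay the same and the gcd grows, so the bounds on \<open>r\<close> persist.\<close>
      have gcd: "gcd (a * c) (b * c) = gcd a b * c"
        using assms(5) by (simp add: gcd_mult_right gcd.commute)
      have "gcd a b * 1 \<le> gcd a b * c"
        using assms(5) by (intro mult_left_mono) auto
      then have "r < a * c div gcd (a * c) (b * c)" "r < b * c div gcd (a * c) (b * c)" "r < gcd (a * c) (b * c)"
        using r assms(5) by (simp_all add: gcd)
      moreover have "mixed_area (convex hull S2) (convex hull S1) = 1"
        using m(1) by (simp only: mixed_area_commute)
      ultimately show False
        using segment_configuration_impossible [OF S(2,1,3,4) col _ m(4-6)] assms(1,2,5,6) by simp
    qed
    ultimately obtain p where "convex hull S2 = (+) p ` (convex hull S1)"
      using mixed_area_1_translate [OF S(1,2)] m(1) by metis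
    \<comment> \<open>Translates have the same mixed area with the third polygon, which contradicts
      \<open>c > 1\<close>.\<close>
    then have "real_of_int (a * c) = of_int a"
      using m(2,4) by (simp only: mixed_area_translation)
    then have "a * c = a" by (simp only: of_int_eq_iff)
    with assms(1,5) show False by simp
  qed
qed

end
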